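(* Both $S_1(\omega)$ and $S(\omega)$, as subspaces of $C_k(\omega^*,\omega^* )$, are Choquet and hence Baire.
   Context: $\omega$ carries the discrete topology, $\beta\omega$ is its Stone–Čech compactification and $\omega^*=\beta\omega\setminus\omega$ is the remainder. For a finite-to-one map $\phi\colon\omega\to\omega$ (all fibres finite), the Stone–Čech extension $\beta\phi\colon\beta\omega\to\beta\omega$ restricts to a continuous map $\omega^*\to\omega^*$, again denoted $\beta\phi$. $C_k(X,Y)$ denotes the set of continuous functions $X\to Y$ with the compact-open topology, generated by the subbasis of sets $[C,U]=\{f : f(C)\subseteq U\}$ with $C\subseteq X$ compact and $U\subseteq Y$ open. $S_1(\omega)\subseteq C_k(\omega^*,\omega^* )$ is the set of all $\beta\phi$ with $\phi\colon\omega\to\omega$ injective, and $S(\omega)\subseteq C_k(\omega^*,\omega^* )$ is the set of all $\beta\phi$ with $\phi\colon\omega\to\omega$ finite-to-one. The Choquet game on a space $Z$ is a game of length $\omega$ between players E and NE. The players alternately choose non-empty open sets, E moving first, each set being contained in the set previously chosen by the opponent. E wins if the intersection of all the chosen sets is empty; otherwise NE wins. $Z$ is Choquet if NE has a winning strategy. $Z$ is Baire if every countable intersection of dense open subsets is dense. *)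

theory Defs
  imports "HOL-Analysis.Analysis"
begin

section \<open>The compactification \<open>\<beta>\<omega>\<close> and its remainder\<close>

text \<open>
  As usual, the points of the Stone--Cech compactification of the discrete space \<open>\<omega>\<close> are the
  ultrafilters on \<open>\<omega>\<close>, with \<open>n \<in> \<omega>\<close> identified with the principal ultrafilter at \<open>n\<close>, and
  the sets \<open>stone A\<close> of ultrafilters containing \<open>A\<close> form a base.
  The lemmas \<open>compact_space_beta_omega\<close>, \<open>Hausdorff_space_beta_omega\<close>,
  \<open>beta_omega_embedding\<close>, \<open>beta_omega_dense\<close> and \<open>beta_omega_universal\<close> below show that this is
  a compactification with the universal property characterising \<open>\<beta>\<omega>\<close>.
\<close>

definition ultrafilters :: "nat filter set" where
  "ultrafilters = {p. p \<noteq> bot \<and> (\<forall>A. eventually (\<lambda>n. n \<in> A) p \<or> eventually (\<lambda>n. n \<notin> A) p)}"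

definition stone :: "nat set \<Rightarrow> nat filter set" where
  "stone A = {p \<in> ultrafilters. eventually (\<lambda>n. n \<in> A) p}"

definition beta_omega :: "nat filter topology" where
  "beta_omega = topology_generated_by (range stone)"

definition pt :: "nat \<Rightarrow> nat filter" where
  "pt n = principal {n}"

definition omega_star :: "nat filter topology" where
  "omega_star = subtopology beta_omega (topspace beta_omega - range pt)"

text \<open>
  The Stone--Cech extension of \<open>\<phi> : \<omega> \<rightarrow> \<omega>\<close>: the unique continuous self-map of \<open>\<beta>\<omega>\<close> extending
  \<open>\<phi>\<close>.  It exists and is the pushforward of ultrafilters, see \<open>beta_map_eq\<close>.
\<close>

definition beta_map :: "(nat \<Rightarrow> nat) \<Rightarrow> nat filter \<Rightarrow> nat filter" where
  "beta_map \<phi> = (THE g. g \<in> extensional (topspace beta_omega) \<and>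
     continuous_map beta_omega beta_omega g \<and> (\<forall>n. g (pt n) = pt (\<phi> n)))"

section \<open>The compact-open topology and the spaces \<open>S\<^sub>1(\<omega>)\<close> and \<open>S(\<omega>)\<close>\<close>

text \<open>Functions on a space are represented by extensional functions on its carrier.\<close>

definition cont_maps :: "'a topology \<Rightarrow> 'b topology \<Rightarrow> ('a \<Rightarrow> 'b) set" where
  "cont_maps X Y = {f \<in> extensional (topspace X). continuous_map X Y f}"

definition compact_open :: "'a topology \<Rightarrow> 'b topology \<Rightarrow> ('a \<Rightarrow> 'b) topology" where
  "compact_open X Y =
     topology_generated_by {{f \<in> cont_maps X Y. f ` C \<subseteq> U} | C U. compactin X C \<and> openin Y U}"

definition beta_star :: "(nat \<Rightarrow> nat) \<Rightarrow> nat filter \<Rightarrow> nat filter" where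
  "beta_star \<phi> = restrict (beta_map \<phi>) (topspace omega_star)"

definition finite_to_one :: "(nat \<Rightarrow> nat) \<Rightarrow> bool" where
  "finite_to_one \<phi> \<longleftrightarrow> (\<forall>n. finite (\<phi> -` {n}))"

definition S1_omega :: "(nat filter \<Rightarrow> nat filter) set" where
  "S1_omega = {beta_star \<phi> | \<phi>. inj \<phi>}"

definition S_omega :: "(nat filter \<Rightarrow> nat filter) set" where
  "S_omega = {beta_star \<phi> | \<phi>. finite_to_one \<phi>}"

section \<open>Choquet and Baire spaces\<close>

text \<open>
  A position of the Choquet game is the list of all sets chosen so far, in order of play.  Player E
  chooses the entries with even index and NE those with odd index, so NE is to move exactly at the
  positions of odd length.  A strategy for NE may depend on the entire position.
\<close>

definition choquet_position :: "'a topology \<Rightarrow> 'a set list \<Rightarrow> bool" where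
  "choquet_position Z xs \<longleftrightarrow>
     (\<forall>i < length xs. openin Z (xs ! i) \<and> xs ! i \<noteq> {}) \<and>
     (\<forall>i. Suc i < length xs \<longrightarrow> xs ! Suc i \<subseteq> xs ! i)"

definition NE_strategy :: "'a topology \<Rightarrow> ('a set list \<Rightarrow> 'a set) \<Rightarrow> bool" where
  "NE_strategy Z \<sigma> \<longleftrightarrow>
     (\<forall>xs. choquet_position Z xs \<and> odd (length xs) \<longrightarrow> choquet_position Z (xs @ [\<sigma> xs]))"

definition choquet_play :: "'a topology \<Rightarrow> (nat \<Rightarrow> 'a set) \<Rightarrow> bool" where
  "choquet_play Z W \<longleftrightarrow> (\<forall>n. choquet_position Z (map W [0..<n]))"

definition NE_follows :: "('a set list \<Rightarrow> 'a set) \<Rightarrow> (nat \<Rightarrow> 'a set) \<Rightarrow> bool" where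
  "NE_follows \<sigma> W \<longleftrightarrow> (\<forall>n. odd n \<longrightarrow> W n = \<sigma> (map W [0..<n]))"

definition Choquet_space :: "'a topology \<Rightarrow> bool" where
  "Choquet_space Z \<longleftrightarrow>
     (\<exists>\<sigma>. NE_strategy Z \<sigma> \<and>
          (\<forall>W. choquet_play Z W \<and> NE_follows \<sigma> W \<longrightarrow> (\<Inter>n. W n) \<noteq> {}))"

definition Baire_space :: "'a topology \<Rightarrow> bool" where
  "Baire_space Z \<longleftrightarrow>
     (\<forall>\<G>. countable \<G> \<and> (\<forall>G \<in> \<G>. openin Z G \<and> Z closure_of G = topspace Z) \<longrightarrow>
          Z closure_of (topspace Z \<inter> \<Inter>\<G>) = topspace Z)"

section \<open>\<open>\<beta>\<omega>\<close> is the Stone--Cech compactification of \<open>\<omega>\<close>\<close>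

lemma topspace_beta_omega: "topspace beta_omega = ultrafilters"
proof -
  have "stone UNIV = ultrafilters" by (auto simp: stone_def)
  moreover have "stone A \<subseteq> ultrafilters" for A by (auto simp: stone_def)
  ultimately show ?thesis unfolding beta_omega_def topology_generated_by_topspace by blast
qed

lemma openin_stone: "openin beta_omega (stone A)"
  unfolding beta_omega_def by (rule topology_generated_by_Basis) auto

lemma ultrafilter_dichotomy:
  assumes "p \<in> ultrafilters"
  shows "eventually (\<lambda>n. n \<in> A) p \<or> eventually (\<lambda>n. n \<notin> A) p"
  using assms by (simp add: ultrafilters_def)

lemma stone_Int: "stone A \<inter> stone B = stone (A \<inter> B)"
  by (auto simp: stone_def eventually_conj_iff)

lemma stone_Compl: "stone (- A) = ultrafilters - stone A"
proof -
  have "\<not> eventually (\<lambda>n. n \<in> A) p" if "p \<noteq> bot" "eventually (\<lambda>n. n \<notin> A) p" for p :: "nat filter"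
  proof
    assume "eventually (\<lambda>n. n \<in> A) p"
    with that(2) have "eventually (\<lambda>n. False) p" by eventually_elim auto
    then show False using that(1) by (simp add: trivial_limit_def)
  qed
  then show ?thesis by (auto simp: stone_def ultrafilters_def)
qed

lemma openin_beta_omega:
  "openin beta_omega U \<longleftrightarrow> U \<subseteq> ultrafilters \<and> (\<forall>p\<in>U. \<exists>A. p \<in> stone A \<and> stone A \<subseteq> U)"
proof
  assume "openin beta_omega U"
  then have "generate_topology_on (range stone) U"
    by (simp add: beta_omega_def openin_topology_generated_by_iff)
  then have "\<forall>p\<in>U. \<exists>A. p \<in> stone A \<and> stone A \<subseteq> U"
  proof (induction rule: generate_topology_on.induct)
    case (Int a b)
    then show ?case by (metis IntE IntI le_infI stone_Int inf.coboundedI1 inf.coboundedI2)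
  next
    case (UN K)
    then show ?case by (meson Union_iff Union_upper order_trans)
  qed auto
  moreover have "U \<subseteq> ultrafilters"
    using openin_subset[OF \<open>openin beta_omega U\<close>] by (simp add: topspace_beta_omega)
  ultimately show "U \<subseteq> ultrafilters \<and> (\<forall>p\<in>U. \<exists>A. p \<in> stone A \<and> stone A \<subseteq> U)" by simp
next
  assume "U \<subseteq> ultrafilters \<and> (\<forall>p\<in>U. \<exists>A. p \<in> stone A \<and> stone A \<subseteq> U)"
  then show "openin beta_omega U" by (meson openin_stone openin_subopen)
qed

lemma pt_ultrafilter: "pt n \<in> ultrafilters"
  by (auto simp: pt_def ultrafilters_def eventually_principal principal_eq_bot_iff)

lemma pt_in_stone: "pt n \<in> stone A \<longleftrightarrow> n \<in> A"
  using pt_ultrafilter[of n] by (simp add: stone_def pt_def eventually_principal)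

lemma ultrafilter_below:
  fixes F :: "nat filter"
  assumes "F \<noteq> bot"
  shows "\<exists>p\<in>ultrafilters. p \<le> F"
proof -
  let ?A = "{G. G \<noteq> bot \<and> G \<le> F}"
  let ?P = "\<lambda>G H :: nat filter. H \<le> G"
  have po: "partial_order_on ?A (relation_of ?P ?A)"
    by (rule partial_order_on_relation_ofI) auto
  have "\<exists>u\<in>?A. \<forall>G\<in>C. u \<le> G" if C: "C \<in> Chains (relation_of ?P ?A)" for C
  proof (cases "C = {}")
    case True
    then show ?thesis using assms by auto
  next
    case False
    have sub: "C \<subseteq> ?A" and lin: "\<And>G H. G \<in> C \<Longrightarrow> H \<in> C \<Longrightarrow> G \<le> H \<or> H \<le> G"
      using C by (auto simp: Chains_def relation_of_def)
    have "eventually (\<lambda>n. False) (Inf C) \<longleftrightarrow> (\<exists>G\<in>C. eventually (\<lambda>n. False) G)"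
      by (rule eventually_Inf_base[OF False]) (use lin in \<open>metis inf.orderE inf.orderI inf_commute order_refl le_inf_iff\<close>)
    then have "Inf C \<noteq> bot" using sub by (auto simp: trivial_limit_def)
    moreover have "Inf C \<le> F" using False sub by (blast intro: Inf_lower2)
    ultimately show ?thesis by (intro bexI[of _ "Inf C"]) (auto intro: Inf_lower)
  qed
  from predicate_Zorn[OF po this]
  obtain p where p: "p \<noteq> bot" "p \<le> F" and min: "\<And>G. G \<noteq> bot \<Longrightarrow> G \<le> p \<Longrightarrow> G = p"
    by (metis (mono_tags, lifting) mem_Collect_eq order_trans)
  have "eventually (\<lambda>n. n \<in> A) p \<or> eventually (\<lambda>n. n \<notin> A) p" for A
  proof (cases "inf p (principal A) = bot")
    case True
    then have "eventually (\<lambda>n. False) (inf p (principal A))" by simp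
    then show ?thesis by (simp add: eventually_inf_principal)
  next
    case False
    then have "inf p (principal A) = p" by (rule min) simp
    then have "p \<le> principal A" by (metis inf.cobounded2)
    then show ?thesis by (simp add: le_principal)
  qed
  then show ?thesis using p unfolding ultrafilters_def by blast
qed

lemma ultrafilter_finite_Union:
  assumes p: "p \<in> ultrafilters" and "finite I" and ev: "eventually (\<lambda>n. n \<in> (\<Union>i\<in>I. A i)) p"
  shows "\<exists>i\<in>I. eventually (\<lambda>n. n \<in> A i) p"
proof (rule ccontr)
  assume "\<not> ?thesis"
  then have "\<forall>i\<in>I. eventually (\<lambda>n. n \<notin> A i) p" using p by (auto simp: ultrafilters_def)
  then have "eventually (\<lambda>n. \<forall>i\<in>I. n \<notin> A i) p" using \<open>finite I\<close> by (simp add: eventually_ball_finite)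
  with ev have "eventually (\<lambda>n. False) p" by eventually_elim auto
  then show False using p by (simp add: ultrafilters_def trivial_limit_def)
qed

lemma compact_space_beta_omega: "compact_space beta_omega"
  unfolding compact_space
proof (intro allI impI, elim conjE)
  fix \<U> assume op: "\<forall>U\<in>\<U>. openin beta_omega U" and cov: "\<Union>\<U> = topspace beta_omega"
  define \<A> where "\<A> = {A. \<exists>U\<in>\<U>. stone A \<subseteq> U}"
  have "\<exists>\<F>. finite \<F> \<and> \<F> \<subseteq> \<A> \<and> \<Union>\<F> = UNIV"
  proof (rule ccontr)
    assume neg: "\<not> ?thesis"
    let ?F = "INF A\<in>\<A>. principal (- A)"
    have "?F \<noteq> bot"
    proof
      assume "?F = bot"
      then have "eventually (\<lambda>n. False) ?F" by simp
      then obtain X where X: "X \<subseteq> \<A>" "finite X"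
          "eventually (\<lambda>n. False) (INF A\<in>X. principal (- A))"
        using eventually_INF[of "\<lambda>n. False" "\<lambda>A. principal (- A)" \<A>] by auto
      have "(INF A\<in>X. principal (- A)) = principal (\<Inter>A\<in>X. - A)"
        using X(2) by (rule INF_principal_finite)
      then have "\<Union>X = UNIV" using X(3) by (auto simp: eventually_principal)
      then show False using X neg by blast
    qed
    then obtain p where p: "p \<in> ultrafilters" "p \<le> ?F" using ultrafilter_below by blast
    then obtain U where "U \<in> \<U>" "p \<in> U" using cov by (auto simp: topspace_beta_omega)
    then obtain A where A: "p \<in> stone A" "A \<in> \<A>" using op unfolding openin_beta_omega \<A>_def by blast
    have "p \<le> principal (- A)" using p(2) A(2) by (meson INF_lower order_trans)
    then have "p \<in> stone (- A)" using p(1) by (simp add: stone_def le_principal)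
    then show False using A(1) by (simp add: stone_Compl)
  qed
  then obtain \<F> where F: "finite \<F>" "\<F> \<subseteq> \<A>" "\<Union>\<F> = UNIV" by metis
  have "\<forall>A\<in>\<F>. \<exists>U. U \<in> \<U> \<and> stone A \<subseteq> U" using F(2) unfolding \<A>_def by blast
  then obtain u where u: "\<And>A. A \<in> \<F> \<Longrightarrow> u A \<in> \<U> \<and> stone A \<subseteq> u A" by metis
  have "topspace beta_omega \<subseteq> \<Union>(u ` \<F>)"
  proof
    fix p assume "p \<in> topspace beta_omega"
    then have p: "p \<in> ultrafilters" by (simp add: topspace_beta_omega)
    have "eventually (\<lambda>n. n \<in> (\<Union>A\<in>\<F>. A)) p" using F(3) by simp
    from ultrafilter_finite_Union[OF p F(1) this]
    obtain A where "A \<in> \<F>" "p \<in> stone A" using p by (auto simp: stone_def)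
    then show "p \<in> \<Union>(u ` \<F>)" using u by blast
  qed
  moreover have "\<Union>(u ` \<F>) \<subseteq> topspace beta_omega" using u cov by blast
  ultimately show "\<exists>\<F>. finite \<F> \<and> \<F> \<subseteq> \<U> \<and> \<Union>\<F> = topspace beta_omega"
    using F(1) u by (intro exI[of _ "u ` \<F>"]) auto
qed

lemma Hausdorff_space_beta_omega: "Hausdorff_space beta_omega"
  unfolding Hausdorff_space_def
proof (intro allI impI, elim conjE)
  fix p q assume "p \<in> topspace beta_omega" "q \<in> topspace beta_omega" and ne: "p \<noteq> q"
  then have pq: "p \<in> ultrafilters" "q \<in> ultrafilters" by (auto simp: topspace_beta_omega)
  obtain A where A: "p \<in> stone A" "q \<notin> stone A"
  proof -
    obtain P where "eventually P p \<noteq> eventually P q" using ne by (auto simp: filter_eq_iff)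
    then have "(p \<in> stone {n. P n}) \<noteq> (q \<in> stone {n. P n})" using pq by (simp add: stone_def)
    then have "p \<in> stone {n. P n} \<and> q \<notin> stone {n. P n} \<or>
               p \<in> stone (- {n. P n}) \<and> q \<notin> stone (- {n. P n})"
      unfolding stone_Compl using pq by blast
    then show ?thesis using that by blast
  qed
  then show "\<exists>U V. openin beta_omega U \<and> openin beta_omega V \<and> p \<in> U \<and> q \<in> V \<and> disjnt U V"
    using pq openin_stone[of A] openin_stone[of "- A"] unfolding stone_Compl disjnt_def by blast
qed

lemma beta_omega_dense: "beta_omega closure_of (range pt) = topspace beta_omega"
proof -
  have "\<exists>y\<in>range pt. y \<in> T" if T: "p \<in> T" "openin beta_omega T" for p T
  proof -
    obtain A where A: "p \<in> stone A" "stone A \<subseteq> T" using T by (auto simp: openin_beta_omega)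
    have "A \<noteq> {}" using A(1) by (auto simp: stone_def ultrafilters_def trivial_limit_def)
    then obtain n where "n \<in> A" by blast
    then show ?thesis using A(2) pt_in_stone by blast
  qed
  then show ?thesis by (auto simp: closure_of_def)
qed

lemma beta_omega_embedding: "embedding_map (discrete_topology UNIV) beta_omega pt"
proof -
  have inj: "inj pt" by (metis injI pt_in_stone singletonD singletonI)
  have "\<exists>T. openin beta_omega T \<and> pt ` A = T \<inter> range pt" for A
    by (rule exI[of _ "stone A"]) (auto simp: openin_stone pt_in_stone)
  then have "open_map (discrete_topology UNIV) (subtopology beta_omega (range pt)) pt"
    by (auto simp: open_map_def openin_subtopology)
  moreover have "continuous_map (discrete_topology UNIV) (subtopology beta_omega (range pt)) pt"
    using pt_ultrafilter by (auto simp: topspace_beta_omega)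
  ultimately have "homeomorphic_map (discrete_topology UNIV) (subtopology beta_omega (range pt)) pt"
    using inj pt_ultrafilter
    by (intro bijective_open_imp_homeomorphic_map) (auto simp: topspace_beta_omega)
  then show ?thesis by (simp add: embedding_map_def)
qed

lemma beta_omega_maps_eq:
  assumes "Hausdorff_space K" "continuous_map beta_omega K g" "continuous_map beta_omega K h"
    and "\<And>n. g (pt n) = h (pt n)" "p \<in> ultrafilters"
  shows "g p = h p"
  by (rule forall_in_closure_of_eq[of p beta_omega "range pt" K g h])
     (use assms in \<open>auto simp: beta_omega_dense topspace_beta_omega\<close>)

lemma beta_omega_universal:
  fixes K :: "'k topology"
  assumes K: "compact_space K" "Hausdorff_space K" and f: "range f \<subseteq> topspace K"
  shows "\<exists>!g. g \<in> extensional (topspace beta_omega) \<and> continuous_map beta_omega K g \<and>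
              (\<forall>n. g (pt n) = f n)"
proof (rule ex_ex1I)
  have lim: "\<exists>y\<in>topspace K. \<forall>U. openin K U \<and> y \<in> U \<longrightarrow> p \<in> stone (f -` U)"
    if p: "p \<in> ultrafilters" for p
  proof (rule ccontr)
    assume "\<not> ?thesis"
    then have "\<forall>y\<in>topspace K. \<exists>U. openin K U \<and> y \<in> U \<and> p \<notin> stone (f -` U)" by blast
    then obtain U where U: "\<And>y. y \<in> topspace K \<Longrightarrow> openin K (U y) \<and> y \<in> U y \<and> p \<notin> stone (f -` U y)"
      by metis
    have "\<exists>\<F>. finite \<F> \<and> \<F> \<subseteq> U ` topspace K \<and> topspace K \<subseteq> \<Union>\<F>"
      using K(1)[unfolded compact_space_alt, rule_format, of "U ` topspace K"] U by blast
    then obtain Y where Y: "finite Y" "Y \<subseteq> topspace K" "topspace K \<subseteq> \<Union>(U ` Y)"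
      by (metis finite_subset_image)
    have "n \<in> (\<Union>y\<in>Y. f -` U y)" for n
      using subsetD[OF Y(3), of "f n"] f by blast
    then have "eventually (\<lambda>n. n \<in> (\<Union>y\<in>Y. f -` U y)) p" by (intro always_eventually) blast
    from ultrafilter_finite_Union[OF p Y(1) this] show False
      using U Y(2) p unfolding stone_def by blast
  qed
  then obtain h where h: "\<And>p. p \<in> ultrafilters \<Longrightarrow> h p \<in> topspace K"
    and hU: "\<And>p U. p \<in> ultrafilters \<Longrightarrow> openin K U \<Longrightarrow> h p \<in> U \<Longrightarrow> p \<in> stone (f -` U)"
    by metis
  have hpt: "h (pt n) = f n" for n
  proof (rule ccontr)
    assume "h (pt n) \<noteq> f n"
    then obtain U where "openin K U" "h (pt n) \<in> U" "f n \<notin> U"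
      using K(2) h[OF pt_ultrafilter] f
      by (metis Hausdorff_imp_t1_space UNIV_I image_subset_iff t1_space_def)
    then show False using hU[OF pt_ultrafilter] by (simp add: pt_in_stone)
  qed
  have cont: "continuous_map beta_omega K h"
    unfolding continuous_map_def
  proof (intro conjI allI impI)
    show "h \<in> topspace beta_omega \<rightarrow> topspace K" using h by (auto simp: topspace_beta_omega)
    fix U assume U: "openin K U"
    have "\<exists>A. p \<in> stone A \<and> stone A \<subseteq> {q \<in> ultrafilters. h q \<in> U}"
      if p: "p \<in> ultrafilters" "h p \<in> U" for p
    proof -
      have "neighbourhood_base_of (closedin K) K"
        using K by (simp add: neighbourhood_base_of_closedin compact_Hausdorff_imp_regular_space)
      note nb = this[unfolded neighbourhood_base_of, rule_format, of U "h p"]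
      then obtain V C where V: "openin K V" "closedin K C" "h p \<in> V" "V \<subseteq> C" "C \<subseteq> U"
        using nb U p(2) by auto
      have "h q \<in> C" if q: "q \<in> stone (f -` V)" for q
      proof (rule ccontr)
        assume "h q \<notin> C"
        moreover have qu: "q \<in> ultrafilters" using q by (simp add: stone_def)
        ultimately have "q \<in> stone (f -` (topspace K - C))"
          using V(2) h[OF qu] by (intro hU) auto
        with q have "q \<in> stone (f -` V \<inter> f -` (topspace K - C))" by (simp flip: stone_Int)
        moreover have "f -` V \<inter> f -` (topspace K - C) = {}" using V(4) by blast
        ultimately have "eventually (\<lambda>n. False) q" by (simp add: stone_def)
        then show False using qu by (simp add: ultrafilters_def trivial_limit_def)
      qed
      then have "stone (f -` V) \<subseteq> {q \<in> ultrafilters. h q \<in> U}"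
        using V(5) by (auto simp: stone_def)
      then show ?thesis using hU[OF p(1) V(1,3)] by blast
    qed
    then show "openin beta_omega {p \<in> topspace beta_omega. h p \<in> U}"
      unfolding openin_beta_omega topspace_beta_omega by auto
  qed
  show "\<exists>g. g \<in> extensional (topspace beta_omega) \<and> continuous_map beta_omega K g \<and>
              (\<forall>n. g (pt n) = f n)"
  proof (intro exI conjI allI)
    show "restrict h (topspace beta_omega) \<in> extensional (topspace beta_omega)" by simp
    show "continuous_map beta_omega K (restrict h (topspace beta_omega))"
      by (rule continuous_map_eq[OF cont]) simp
    show "restrict h (topspace beta_omega) (pt n) = f n" for n
      using hpt pt_ultrafilter by (simp add: topspace_beta_omega)
  qed
next
  fix g h
  assume g: "g \<in> extensional (topspace beta_omega) \<and> continuous_map beta_omega K g \<and>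
              (\<forall>n. g (pt n) = f n)"
    and h: "h \<in> extensional (topspace beta_omega) \<and> continuous_map beta_omega K h \<and>
              (\<forall>n. h (pt n) = f n)"
  show "g = h"
  proof (rule extensionalityI[of g "topspace beta_omega" h])
    show "g p = h p" if "p \<in> topspace beta_omega" for p
      using that g h K(2) by - (rule beta_omega_maps_eq[of K], auto simp: topspace_beta_omega)
  qed (use g h in auto)
qed

section \<open>The maps \<open>\<beta>\<phi>\<close>\<close>

lemma beta_map_props:
  "beta_map \<phi> \<in> extensional (topspace beta_omega)"
  "continuous_map beta_omega beta_omega (beta_map \<phi>)"
  "beta_map \<phi> (pt n) = pt (\<phi> n)"
proof -
  have "range (\<lambda>n. pt (\<phi> n)) \<subseteq> topspace beta_omega"
    using pt_ultrafilter by (auto simp: topspace_beta_omega)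
  from theI'[OF beta_omega_universal[OF compact_space_beta_omega Hausdorff_space_beta_omega this]]
  show "beta_map \<phi> \<in> extensional (topspace beta_omega)"
    "continuous_map beta_omega beta_omega (beta_map \<phi>)" "beta_map \<phi> (pt n) = pt (\<phi> n)"
    unfolding beta_map_def by blast+
qed

lemma filtermap_ultrafilter: "p \<in> ultrafilters \<Longrightarrow> filtermap \<phi> p \<in> ultrafilters"
proof -
  assume p: "p \<in> ultrafilters"
  have "eventually (\<lambda>n. \<phi> n \<in> A) p \<or> eventually (\<lambda>n. \<phi> n \<notin> A) p" for A
  proof -
    have "eventually (\<lambda>n. n \<in> \<phi> -` A) p \<or> eventually (\<lambda>n. n \<notin> \<phi> -` A) p"
      by (rule ultrafilter_dichotomy[OF p])
    then show ?thesis by simp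
  qed
  then show ?thesis using p by (simp add: ultrafilters_def filtermap_bot_iff eventually_filtermap)
qed

lemma beta_map_eq:
  assumes p: "p \<in> ultrafilters"
  shows "beta_map \<phi> p = filtermap \<phi> p"
proof (rule beta_omega_maps_eq[OF Hausdorff_space_beta_omega beta_map_props(2) _ _ p])
  have *: "\<exists>B. q \<in> stone B \<and> stone B \<subseteq> {q \<in> ultrafilters. filtermap \<phi> q \<in> U}"
    if U: "openin beta_omega U" and q: "q \<in> ultrafilters" "filtermap \<phi> q \<in> U" for U q
  proof -
    obtain A where A: "filtermap \<phi> q \<in> stone A" "stone A \<subseteq> U"
      using U q by (auto simp: openin_beta_omega)
    have "stone (\<phi> -` A) \<subseteq> {q \<in> ultrafilters. filtermap \<phi> q \<in> U}"
      using A(2) filtermap_ultrafilter by (auto simp: stone_def eventually_filtermap)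
    moreover have "q \<in> stone (\<phi> -` A)"
      using A(1) q(1) by (simp add: stone_def eventually_filtermap)
    ultimately show ?thesis by blast
  qed
  show "continuous_map beta_omega beta_omega (filtermap \<phi>)"
  proof (unfold continuous_map_def topspace_beta_omega, intro conjI allI impI)
    show "filtermap \<phi> \<in> ultrafilters \<rightarrow> ultrafilters" using filtermap_ultrafilter by blast
    fix U assume U: "openin beta_omega U"
    show "openin beta_omega {p \<in> ultrafilters. filtermap \<phi> p \<in> U}"
      by (rule openin_beta_omega[THEN iffD2]) (use *[OF U] in simp)
  qed
  show "beta_map \<phi> (pt n) = filtermap \<phi> (pt n)" for n
    unfolding beta_map_props(3) by (simp add: pt_def filtermap_principal)
qed

lemma topspace_omega_star: "topspace omega_star = ultrafilters - range pt"
  by (auto simp: omega_star_def topspace_beta_omega)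

lemma principal_if_finite:
  assumes p: "p \<in> ultrafilters" and "finite A" and "eventually (\<lambda>n. n \<in> A) p"
  shows "p \<in> range pt"
proof -
  have "eventually (\<lambda>n. n \<in> (\<Union>i\<in>A. {i})) p" using assms(3) by simp
  from ultrafilter_finite_Union[OF p assms(2) this]
  obtain i where i: "eventually (\<lambda>n. n = i) p" by auto
  have "eventually P p \<longleftrightarrow> eventually P (pt i)" for P
  proof
    assume "eventually P p"
    with i have "eventually (\<lambda>n. P i) p" by eventually_elim auto
    then show "eventually P (pt i)"
      using p by (cases "P i") (auto simp: ultrafilters_def trivial_limit_def pt_def eventually_principal)
  next
    assume "eventually P (pt i)"
    then have "P i" by (simp add: pt_def eventually_principal)
    with i show "eventually P p" by (auto elim: eventually_mono)
  qed
  then show ?thesis by (auto simp: filter_eq_iff)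
qed

lemma beta_star_in_cont_maps:
  assumes "finite_to_one \<phi>"
  shows "beta_star \<phi> \<in> cont_maps omega_star omega_star"
proof -
  have ran: "beta_map \<phi> p \<in> ultrafilters - range pt" if p: "p \<in> ultrafilters - range pt" for p
  proof -
    have "filtermap \<phi> p \<noteq> pt n" for n
    proof
      assume eq: "filtermap \<phi> p = pt n"
      have "eventually (\<lambda>m. m = n) (pt n)" by (simp add: pt_def eventually_principal)
      then have "eventually (\<lambda>m. m \<in> \<phi> -` {n}) p"
        unfolding eq[symmetric] by (simp add: eventually_filtermap)
      moreover have "finite (\<phi> -` {n})" using assms by (simp add: finite_to_one_def)
      ultimately show False using principal_if_finite[of p] p by blast
    qed
    then show ?thesis using p filtermap_ultrafilter by (auto simp: beta_map_eq)
  qed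
  have "continuous_map omega_star omega_star (beta_map \<phi>)"
    unfolding omega_star_def
    using ran beta_map_props(2)
    by (auto simp: continuous_map_in_subtopology topspace_beta_omega image_subset_iff
             intro!: continuous_map_from_subtopology)
  then have "continuous_map omega_star omega_star (beta_star \<phi>)"
    unfolding beta_star_def by (rule continuous_map_eq) simp
  then show ?thesis by (simp add: cont_maps_def beta_star_def)
qed

lemma topspace_compact_open: "topspace (compact_open X Y) = cont_maps X Y"
proof -
  have "cont_maps X Y \<in> {{f \<in> cont_maps X Y. f ` C \<subseteq> U} | C U. compactin X C \<and> openin Y U}"
    by (rule CollectI, rule exI[of _ "{}"], rule exI[of _ "{}"]) auto
  then show ?thesis unfolding compact_open_def topology_generated_by_topspace by blast
qed

lemma S_omega_subset: "S1_omega \<subseteq> S_omega" "S_omega \<subseteq> topspace (compact_open omega_star omega_star)"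
proof -
  have "finite_to_one \<phi>" if "inj \<phi>" for \<phi>
    using that by (auto simp: finite_to_one_def intro: finite_vimageI)
  then show "S1_omega \<subseteq> S_omega" by (auto simp: S1_omega_def S_omega_def)
  show "S_omega \<subseteq> topspace (compact_open omega_star omega_star)"
    using beta_star_in_cont_maps by (auto simp: S_omega_def topspace_compact_open)
qed

end

theory Submission
  imports Defs
begin

text \<open>
  By compactness of \<open>\<omega>\<^sup>*\<close> and the clopen base of sets \<open>stone B\<close>, a continuous self-map \<open>f\<close> of
  \<open>\<omega>\<^sup>*\<close> has a neighbourhood base in the compact-open topology consisting of the cells
  \<open>cell \<F> f\<close> with \<open>\<F>\<close> a finite set of subsets of \<open>\<omega>\<close>: the maps that pull back each clopen set
  given by a \<open>B \<in> \<F>\<close> to the same clopen set as \<open>f\<close> does (\<open>openin_cell\<close>,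
  \<open>cell_neighbourhood\<close>).  For \<open>f = \<beta>\<phi>\<close> and \<open>g = \<beta>\<psi>\<close> membership of \<open>g\<close> in the cell is
  combinatorial: \<open>\<psi> x \<in> B \<longleftrightarrow> \<phi> x \<in> B\<close> for all but finitely many \<open>x\<close> and every \<open>B \<in> \<F>\<close>
  (\<open>beta_star_in_cell_iff\<close>).

  NE answers a move \<open>U\<close> of E with a cell inside \<open>U\<close> around some \<open>\<beta>\<phi> \<in> U\<close>.  A play then yields
  finite-to-one maps \<open>\<phi>\<^sub>n\<close> and finite sets \<open>\<F>\<^sub>n\<close> such that every later \<open>\<phi>\<^sub>m\<close> agrees with
  \<open>\<phi>\<^sub>n\<close> about the members of \<open>\<F>\<^sub>n\<close> up to finitely many arguments.  It has to be shown that
  one map \<open>\<psi>\<close> agrees with all of them in this sense (\<open>coherent_limit\<close>).  Imitating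
  \<open>\<phi>\<^sub>n\<close> on the \<open>n\<close>-th of a sequence of late enough blocks is the right idea, but copying its
  values could destroy injectivity.  However, only the atom of the finite Boolean algebra generated
  by \<open>\<F>\<^sub>0, \<dots>, \<F>\<^sub>n\<close> that contains \<open>\<phi>\<^sub>n x\<close> matters, not the value itself.  As
  \<open>\<phi>\<^sub>n\<close> is finite-to-one, it sends only finitely many arguments into finite atoms, so for late
  \<open>x\<close> there is always room in the atom for a value above all previous ones.  Hence \<open>\<psi>\<close> can even be
  made strictly increasing.  The maps played may thus be arbitrary elements of \<open>S(\<omega>)\<close> while the
  limit lies in \<open>S\<^sub>1(\<omega>)\<close>, so that one argument covers both spaces, and all spaces between
  them (\<open>Choquet_between_S1_and_S\<close>).

  Finally, every Choquet space is Baire: E can meet the given dense open sets one by one, starting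
  inside any given open set (\<open>Choquet_imp_Baire\<close>).
\<close>

section \<open>The Choquet game\<close>

lemma choquet_position_snoc:
  "choquet_position Z (xs @ [w]) \<longleftrightarrow>
     choquet_position Z xs \<and> openin Z w \<and> w \<noteq> {} \<and> (xs \<noteq> [] \<longrightarrow> w \<subseteq> last xs)"
proof (cases xs rule: rev_cases)
  case Nil
  then show ?thesis by (simp add: choquet_position_def)
next
  case (snoc ys y)
  have "(\<forall>i. Suc i < length xs + 1 \<longrightarrow> (xs @ [w]) ! Suc i \<subseteq> (xs @ [w]) ! i) \<longleftrightarrow>
        (\<forall>i. Suc i < length xs \<longrightarrow> xs ! Suc i \<subseteq> xs ! i) \<and> w \<subseteq> y" (is "?L \<longleftrightarrow> ?R")
  proof
    assume L: ?L
    have "xs ! Suc i \<subseteq> xs ! i" if "Suc i < length xs" for i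
      using L[rule_format, of i] that by (simp add: nth_append)
    moreover have "w \<subseteq> y" using L[rule_format, of "length ys"] snoc by (simp add: nth_append)
    ultimately show ?R by blast
  next
    assume R: ?R
    show ?L
    proof (intro allI impI)
      fix i assume "Suc i < length xs + 1"
      then consider "Suc i < length xs" | "i = length ys" using snoc by fastforce
      then show "(xs @ [w]) ! Suc i \<subseteq> (xs @ [w]) ! i"
      proof cases
        case 1
        then show ?thesis using R by (simp add: nth_append)
      next
        case 2
        then have "length xs = Suc i" "xs ! i = y" using snoc by simp_all
        then show ?thesis using R by (simp add: nth_append)
      qed
    qed
  qed
  moreover have "(\<forall>i<length xs + 1. openin Z ((xs @ [w]) ! i) \<and> (xs @ [w]) ! i \<noteq> {}) \<longleftrightarrow>
        (\<forall>i<length xs. openin Z (xs ! i) \<and> xs ! i \<noteq> {}) \<and> openin Z w \<and> w \<noteq> {}"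
    by (auto simp: nth_append less_Suc_eq)
  ultimately show ?thesis using snoc by (auto simp: choquet_position_def)
qed

text \<open>
  NE may try to win with a strategy \<open>s\<close> that looks at the last move of E only.  In this case only
  the moves of E have to be considered, since each of them determines the answer of NE.
\<close>

lemma Choquet_space_stationary:
  assumes s: "\<And>U. openin Z U \<Longrightarrow> U \<noteq> {} \<Longrightarrow> openin Z (s U) \<and> s U \<noteq> {} \<and> s U \<subseteq> U"
    and win: "\<And>U. (\<And>n. openin Z (U n)) \<Longrightarrow> (\<And>n. U n \<noteq> {}) \<Longrightarrow> (\<And>n. U (Suc n) \<subseteq> s (U n)) \<Longrightarrow>
      (\<Inter>n. s (U n)) \<noteq> {}"
  shows "Choquet_space Z"
  unfolding Choquet_space_def
proof (intro exI conjI allI impI)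
  let ?\<sigma> = "\<lambda>xs. s (last xs)"
  show "NE_strategy Z ?\<sigma>"
    unfolding NE_strategy_def
  proof (intro allI impI, elim conjE)
    fix xs assume pos: "choquet_position Z xs" and odd: "odd (length xs)"
    then obtain ys y where "xs = ys @ [y]" by (cases xs rule: rev_cases) auto
    then show "choquet_position Z (xs @ [?\<sigma> xs])"
      using pos s[of y] choquet_position_snoc[of Z ys y] choquet_position_snoc[of Z xs "s y"] by simp
  qed
  fix W assume "choquet_play Z W \<and> NE_follows ?\<sigma> W"
  then have play: "\<And>n. choquet_position Z (map W [0..<n])"
    and follows: "\<And>n. odd n \<Longrightarrow> W n = s (last (map W [0..<n]))"
    by (auto simp: choquet_play_def NE_follows_def)
  have op: "openin Z (W n)" "W n \<noteq> {}" for n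
    using play[of "Suc n"] by (simp_all add: choquet_position_snoc)
  have dec: "W (Suc n) \<subseteq> W n" for n
    using play[of "Suc (Suc n)"] choquet_position_snoc[of Z "map W [0..<Suc n]" "W (Suc n)"] by simp
  have resp: "W (Suc (2 * n)) = s (W (2 * n))" for n
    using follows[of "Suc (2 * n)"] by simp
  have "(\<Inter>n. s (W (2 * n))) \<noteq> {}"
  proof (rule win)
    show "W (2 * Suc n) \<subseteq> s (W (2 * n))" for n
      using dec[of "Suc (2 * n)"] by (simp add: resp)
  qed (use op in auto)
  moreover have "s (W (2 * n)) \<subseteq> W n" for n
  proof -
    have "W (Suc (2 * n)) \<subseteq> W n" by (rule lift_Suc_antimono_le[of W, OF dec]) simp
    then show ?thesis by (simp add: resp)
  qed
  ultimately show "(\<Inter>n. W n) \<noteq> {}" by blast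
qed

text \<open>
  In a play where E starts with \<open>U \<inter> G\<^sub>0\<close> and answers every move of NE by its intersection with
  the next dense open set, any point common to all moves lies in \<open>U\<close> and in each \<open>G\<^sub>n\<close>.
  Density keeps the moves of E non-empty.
\<close>

lemma Choquet_imp_Baire:
  assumes "Choquet_space Z"
  shows "Baire_space Z"
  unfolding Baire_space_def
proof (intro allI impI, elim conjE)
  fix \<G> assume "countable \<G>" and G: "\<forall>G\<in>\<G>. openin Z G \<and> Z closure_of G = topspace Z"
  obtain \<sigma> where strat: "NE_strategy Z \<sigma>"
    and win: "\<And>W. choquet_play Z W \<Longrightarrow> NE_follows \<sigma> W \<Longrightarrow> (\<Inter>n. W n) \<noteq> {}"
    using assms by (auto simp: Choquet_space_def)
  \<comment> \<open>The whole space is added so that there is something to enumerate when \<open>\<G>\<close> is empty.\<close>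
  have "countable (insert (topspace Z) \<G>)" using \<open>countable \<G>\<close> by simp
  then obtain g :: "nat \<Rightarrow> 'a set" where g: "range g = insert (topspace Z) \<G>"
    by (metis empty_not_insert range_from_nat_into)
  have gG: "openin Z (g n)" "Z closure_of (g n) = topspace Z" for n
    using G g by (metis closure_of_topspace insert_iff openin_topspace rangeI)+
  have "\<exists>x \<in> topspace Z \<inter> \<Inter>\<G>. x \<in> U" if U: "openin Z U" "U \<noteq> {}" for U
  proof -
    \<comment> \<open>The next move in the play described above, whoever is to make it.\<close>
    define mv where "mv = (\<lambda>xs. if even (length xs)
      then (if xs = [] then U else last xs) \<inter> g (length xs div 2) else \<sigma> xs)"
    define L where "L = rec_nat [] (\<lambda>_ xs. xs @ [mv xs])"
    define W where "W = (\<lambda>n. mv (L n))"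
    have L: "L n = map W [0..<n]" for n
      by (induction n) (simp_all add: L_def W_def)
    have len: "length (L n) = n" for n by (simp add: L)
    have pos: "choquet_position Z (L n)" for n
    proof (induction n)
      case 0
      then show ?case by (simp add: L_def choquet_position_def)
    next
      case (Suc n)
      have step: "L (Suc n) = L n @ [mv (L n)]" by (simp add: L_def)
      show ?case
      proof (cases "even n")
        case True
        define V where "V = (if L n = [] then U else last (L n))"
        have V: "openin Z V" "V \<noteq> {}"
          using Suc U unfolding V_def
          by (cases "L n" rule: rev_cases; simp add: choquet_position_snoc)+
        have "V \<inter> g (n div 2) \<noteq> {}"
          using V gG[of "n div 2"] dense_intersects_open[of Z "g (n div 2)"] by blast
        then show ?thesis
          using Suc V gG[of "n div 2"] True len
          by (auto simp: step choquet_position_snoc mv_def V_def split: if_splits)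
      next
        case False
        then show ?thesis
          using Suc strat len by (simp add: step mv_def NE_strategy_def)
      qed
    qed
    have "(\<Inter>n. W n) \<noteq> {}"
    proof (rule win)
      show "choquet_play Z W" using pos unfolding choquet_play_def L by blast
      have "W n = \<sigma> (L n)" if "odd n" for n using that by (simp add: W_def mv_def len)
      then show "NE_follows \<sigma> W" unfolding NE_follows_def L by blast
    qed
    then obtain x where x: "\<And>n. x \<in> W n" by blast
    have "x \<in> U" using x[of 0] by (simp add: W_def L_def mv_def)
    moreover have "x \<in> g n" for n using x[of "2 * n"] by (simp add: W_def mv_def len split: if_splits)
    then have "x \<in> topspace Z \<inter> \<Inter>\<G>" using g by blast
    ultimately show ?thesis by blast
  qed
  then show "Z closure_of (topspace Z \<inter> \<Inter>\<G>) = topspace Z"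
    unfolding closure_of_def by blast
qed

section \<open>Clopen sets in the remainder\<close>

lemma omega_star_le_sequentially:
  assumes "p \<in> topspace omega_star"
  shows "p \<le> sequentially"
proof -
  have p: "p \<in> ultrafilters" "p \<notin> range pt" using assms by (auto simp: topspace_omega_star)
  have "eventually P p" if "eventually P sequentially" for P
  proof -
    have "finite {n. \<not> P n}" using that by (simp add: cofinite_eq_sequentially[symmetric] eventually_cofinite)
    then have "\<not> eventually (\<lambda>n. n \<in> {n. \<not> P n}) p"
      using principal_if_finite[OF p(1)] p(2) by blast
    then show ?thesis using ultrafilter_dichotomy[OF p(1), of "{n. P n}"] by simp
  qed
  then show ?thesis by (simp add: filter_leI)
qed

text \<open>
  This translates statements about all points of \<open>\<omega>\<^sup>*\<close> into statements modulo finite sets.  If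
  \<open>P\<close> fails infinitely often, the cofinite filter together with the set where \<open>P\<close> fails generates
  a proper filter, and an ultrafilter below it is a free ultrafilter at which \<open>P\<close> fails.
\<close>

lemma eventually_sequentially_iff_omega_star:
  "eventually P sequentially \<longleftrightarrow> (\<forall>p \<in> topspace omega_star. eventually P p)"
proof
  assume "eventually P sequentially"
  then show "\<forall>p \<in> topspace omega_star. eventually P p"
    using omega_star_le_sequentially by (auto dest: filter_leD)
next
  assume all: "\<forall>p \<in> topspace omega_star. eventually P p"
  show "eventually P sequentially"
  proof (rule ccontr)
    assume neg: "\<not> eventually P sequentially"
    let ?F = "inf sequentially (principal {n. \<not> P n})"
    have "?F \<noteq> bot" using neg by (simp add: trivial_limit_def eventually_inf_principal)
    then obtain p where p: "p \<in> ultrafilters" "p \<le> ?F" using ultrafilter_below by blast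
    have "p \<noteq> pt n" for n
    proof
      assume "p = pt n"
      then have "pt n \<le> sequentially" using p(2) by simp
      moreover have "eventually (\<lambda>m. m > n) sequentially" by (rule eventually_gt_at_top)
      ultimately have "eventually (\<lambda>m. m > n) (pt n)" by (rule filter_leD)
      then show False by (simp add: pt_def eventually_principal)
    qed
    then have "eventually P p" using all p(1) by (auto simp: topspace_omega_star)
    moreover have "eventually (\<lambda>n. \<not> P n) p"
      using filter_leD[OF p(2)] by (simp add: eventually_inf_principal)
    ultimately have "eventually (\<lambda>n. False) p" by eventually_elim auto
    then show False using p(1) by (simp add: ultrafilters_def trivial_limit_def)
  qed
qed

lemma compact_space_omega_star: "compact_space omega_star"
proof -
  have "openin beta_omega {pt n}" for n
  proof -
    have "stone {n} = {pt n}"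
    proof
      show "stone {n} \<subseteq> {pt n}"
      proof
        fix p assume p: "p \<in> stone {n}"
        then have "p \<in> range pt" by (intro principal_if_finite[of p "{n}"]) (auto simp: stone_def)
        then show "p \<in> {pt n}" using p by (auto simp: pt_in_stone)
      qed
    qed (simp add: pt_in_stone)
    then show ?thesis using openin_stone[of "{n}"] by simp
  qed
  then have "openin beta_omega (\<Union>n. {pt n})" by blast
  then have "closedin beta_omega (topspace beta_omega - range pt)"
    by (intro closedin_diff) (simp_all add: UNION_singleton_eq_range)
  then show ?thesis
    unfolding omega_star_def
    using closedin_compact_space[OF compact_space_beta_omega] compact_space_subtopology by blast
qed

section \<open>A neighbourhood base for the compact-open topology\<close>

text \<open>
  In the language of Boolean algebras, a continuous self-map of \<open>\<omega>\<^sup>*\<close> is an endomorphism of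
  \<open>P(\<omega>)/fin\<close>, and a cell prescribes the values of the endomorphism on the finite set \<open>\<F>\<close>; so
  the compact-open topology becomes the topology of pointwise convergence on the discrete algebra.
\<close>

definition cell :: "nat set set \<Rightarrow> (nat filter \<Rightarrow> nat filter) \<Rightarrow> (nat filter \<Rightarrow> nat filter) set" where
  "cell \<F> f = {g \<in> cont_maps omega_star omega_star.
     \<forall>B\<in>\<F>. \<forall>p\<in>topspace omega_star. g p \<in> stone B \<longleftrightarrow> f p \<in> stone B}"

lemma openin_omega_star_stone: "openin omega_star (stone B \<inter> topspace omega_star)"
  by (auto simp: omega_star_def openin_subtopology intro: openin_stone)

lemma compactin_preimage_stone:
  assumes f: "f \<in> cont_maps omega_star omega_star"
  shows "compactin omega_star {p \<in> topspace omega_star. f p \<in> stone B}"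
proof (rule closedin_compact_space[OF compact_space_omega_star])
  have cont: "continuous_map omega_star omega_star f" using f by (simp add: cont_maps_def)
  have "openin omega_star {p \<in> topspace omega_star. f p \<in> stone (- B) \<inter> topspace omega_star}"
    by (rule openin_continuous_map_preimage[OF cont openin_omega_star_stone])
  moreover have "{p \<in> topspace omega_star. f p \<in> stone (- B) \<inter> topspace omega_star}
      = topspace omega_star - {p \<in> topspace omega_star. f p \<in> stone B}"
    using continuous_map_image_subset_topspace[OF cont]
    by (auto simp: stone_Compl topspace_omega_star)
  ultimately show "closedin omega_star {p \<in> topspace omega_star. f p \<in> stone B}"
    by (simp add: closedin_def)
qed

text \<open>
  With \<open>K\<close> the compact preimage of \<open>stone B\<close> under \<open>f\<close> and \<open>L\<close> that of its complement, \<open>g\<close>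
  pulls \<open>stone B\<close> back to \<open>K\<close> if and only if it maps \<open>K\<close> into \<open>stone B\<close> and \<open>L\<close> into
  \<open>stone (- B)\<close>.  These are two subbasic conditions.
\<close>

lemma openin_cell:
  assumes f: "f \<in> cont_maps omega_star omega_star" and "finite \<F>"
  shows "openin (compact_open omega_star omega_star) (cell \<F> f)"
proof -
  let ?X = "topspace omega_star"
  let ?K = "\<lambda>B. {p \<in> ?X. f p \<in> stone B}"
  let ?O = "\<lambda>B. {g \<in> cont_maps omega_star omega_star. g ` ?K B \<subseteq> stone B \<inter> ?X}"
  have op: "openin (compact_open omega_star omega_star) (?O B)" for B
    unfolding compact_open_def
    by (rule topology_generated_by_Basis)
      (use compactin_preimage_stone[OF f] openin_omega_star_stone in blast)
  have into: "g p \<in> ?X" if "g \<in> cont_maps omega_star omega_star" "p \<in> ?X" for g p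
    using that continuous_map_image_subset_topspace[of omega_star omega_star g]
    by (auto simp: cont_maps_def)
  have compl: "g p \<in> stone (- B) \<longleftrightarrow> g p \<notin> stone B"
    if "g \<in> cont_maps omega_star omega_star" "p \<in> ?X" for g p B
    using into[OF that] by (auto simp: stone_Compl topspace_omega_star)
  have "cell \<F> f = cont_maps omega_star omega_star \<inter> (\<Inter>B\<in>\<F>. ?O B \<inter> ?O (- B))"
  proof (intro equalityI subsetI)
    fix g assume "g \<in> cell \<F> f"
    then show "g \<in> cont_maps omega_star omega_star \<inter> (\<Inter>B\<in>\<F>. ?O B \<inter> ?O (- B))"
      using into compl[OF f] compl[of g] by (auto simp: cell_def)
  next
    fix g assume g: "g \<in> cont_maps omega_star omega_star \<inter> (\<Inter>B\<in>\<F>. ?O B \<inter> ?O (- B))"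
    then have gc: "g \<in> cont_maps omega_star omega_star" by blast
    have "g p \<in> stone B \<longleftrightarrow> f p \<in> stone B" if B: "B \<in> \<F>" and p: "p \<in> ?X" for B p
    proof -
      have "g ` ?K B \<subseteq> stone B" "g ` ?K (- B) \<subseteq> stone (- B)" using g B by auto
      then show ?thesis using p compl[OF f p, of B] compl[OF gc p, of B] by blast
    qed
    then show "g \<in> cell \<F> f" using gc by (simp add: cell_def)
  qed
  moreover have "openin (compact_open omega_star omega_star)
      (cont_maps omega_star omega_star \<inter> (\<Inter>B\<in>\<F>. ?O B \<inter> ?O (- B)))"
    using openin_Inter[of "insert (cont_maps omega_star omega_star) ((\<lambda>B. ?O B \<inter> ?O (- B)) ` \<F>)"
        "compact_open omega_star omega_star"] \<open>finite \<F>\<close> op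
      openin_topspace[of "compact_open omega_star omega_star"]
    by (auto simp: topspace_compact_open)
  ultimately show ?thesis by simp
qed

text \<open>
  For a subbasic set of maps sending a compact \<open>C\<close> into an open \<open>V\<close>, the preimages under \<open>f\<close> of
  the basic clopen subsets of \<open>V\<close> cover \<open>C\<close>; the clopen sets of a finite subcover form the
  required \<open>\<F>\<close>, because every map in the cell has the same preimages.
\<close>

lemma cell_neighbourhood:
  assumes U: "openin (compact_open omega_star omega_star) U" and fU: "f \<in> U"
  shows "\<exists>\<F>. finite \<F> \<and> cell \<F> f \<subseteq> U"
proof -
  let ?X = "topspace omega_star"
  have "generate_topology_on
      {{f \<in> cont_maps omega_star omega_star. f ` C \<subseteq> U} | C U. compactin omega_star C \<and> openin omega_star U} U"
    using U by (simp add: compact_open_def openin_topology_generated_by_iff)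
  then show ?thesis using fU
  proof (induction rule: generate_topology_on.induct)
    case Empty
    then show ?case by simp
  next
    case (Int a b)
    then obtain \<A> \<B> where "finite \<A>" "cell \<A> f \<subseteq> a" "finite \<B>" "cell \<B> f \<subseteq> b" by blast
    then show ?case by (intro exI[of _ "\<A> \<union> \<B>"]) (auto simp: cell_def)
  next
    case (UN K)
    then obtain k where k: "k \<in> K" "f \<in> k" by blast
    with UN.IH obtain \<F> where "finite \<F>" "cell \<F> f \<subseteq> k" by blast
    with k show ?case by (meson Union_upper order_trans)
  next
    case (Basis s)
    then obtain C V where s: "s = {f \<in> cont_maps omega_star omega_star. f ` C \<subseteq> V}"
      and C: "compactin omega_star C" and V: "openin omega_star V" by blast
    have f: "f \<in> cont_maps omega_star omega_star" "f ` C \<subseteq> V" using Basis s by auto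
    then have cont: "continuous_map omega_star omega_star f" by (simp add: cont_maps_def)
    obtain V' where V': "openin beta_omega V'" "V = V' \<inter> ?X"
      using V by (auto simp: omega_star_def openin_subtopology)
    have CX: "C \<subseteq> ?X" using C compactin_subset_topspace by blast
    define \<A> where "\<A> = {A. stone A \<inter> ?X \<subseteq> V}"
    let ?P = "\<lambda>A. {p \<in> ?X. f p \<in> stone A \<inter> ?X}"
    have "\<exists>\<U>. finite \<U> \<and> \<U> \<subseteq> ?P ` \<A> \<and> C \<subseteq> \<Union>\<U>"
    proof (rule compactinD[OF C])
      show "openin omega_star W" if "W \<in> ?P ` \<A>" for W
        using that openin_continuous_map_preimage[OF cont openin_omega_star_stone] by blast
      show "C \<subseteq> \<Union>(?P ` \<A>)"
      proof
        fix p assume p: "p \<in> C"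
        then have "f p \<in> V'" "f p \<in> ?X" using f V' by auto
        then obtain A where "f p \<in> stone A" "stone A \<subseteq> V'" using V'(1) by (auto simp: openin_beta_omega)
        then show "p \<in> \<Union>(?P ` \<A>)" using p CX V'(2) \<open>f p \<in> ?X\<close> unfolding \<A>_def by blast
      qed
    qed
    then obtain \<U> where \<U>: "finite \<U>" "\<U> \<subseteq> ?P ` \<A>" "C \<subseteq> \<Union>\<U>" by blast
    obtain \<F> where "\<F> \<subseteq> \<A>" "finite \<F>" "\<U> = ?P ` \<F>"
      using finite_subset_image[OF \<U>(1,2)] by blast
    with \<U>(3) have F: "finite \<F>" "\<F> \<subseteq> \<A>" "C \<subseteq> \<Union>(?P ` \<F>)" by simp_all
    have "cell \<F> f \<subseteq> s"
    proof
      fix g assume g: "g \<in> cell \<F> f"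
      then have "continuous_map omega_star omega_star g" by (simp add: cell_def cont_maps_def)
      then have gX: "g p \<in> ?X" if "p \<in> ?X" for p
        using that continuous_map_image_subset_topspace by fastforce
      have "g p \<in> V" if "p \<in> C" for p
      proof -
        obtain A where A: "A \<in> \<F>" "p \<in> ?P A" using F(3) \<open>p \<in> C\<close> by blast
        then have "g p \<in> stone A \<inter> ?X" using g gX by (auto simp: cell_def)
        then show ?thesis using A(1) F(2) unfolding \<A>_def by blast
      qed
      then show "g \<in> s" using g unfolding s cell_def by blast
    qed
    then show ?case using F(1) by blast
  qed
qed

lemma beta_star_in_stone:
  assumes "p \<in> topspace omega_star"
  shows "beta_star \<phi> p \<in> stone B \<longleftrightarrow> eventually (\<lambda>x. \<phi> x \<in> B) p"
  using assms filtermap_ultrafilter[of p \<phi>]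
  by (auto simp: beta_star_def beta_map_eq topspace_omega_star stone_def eventually_filtermap)

lemma beta_star_in_cell_iff:
  assumes \<psi>: "finite_to_one \<psi>"
  shows "beta_star \<psi> \<in> cell \<F> (beta_star \<phi>) \<longleftrightarrow>
    (\<forall>B\<in>\<F>. \<forall>\<^sub>F x in sequentially. \<psi> x \<in> B \<longleftrightarrow> \<phi> x \<in> B)"
proof -
  have "(eventually (\<lambda>x. \<psi> x \<in> B) p \<longleftrightarrow> eventually (\<lambda>x. \<phi> x \<in> B) p) \<longleftrightarrow>
      eventually (\<lambda>x. \<psi> x \<in> B \<longleftrightarrow> \<phi> x \<in> B) p" if p: "p \<in> topspace omega_star" for p B
  proof -
    have u: "p \<in> ultrafilters" using p by (simp add: topspace_omega_star)
    have dich: "eventually P p \<or> eventually (\<lambda>x. \<not> P x) p" for P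
      using ultrafilter_dichotomy[OF u, of "{x. P x}"] by simp
    have excl: False if "eventually P p" "eventually (\<lambda>x. \<not> P x) p" for P
    proof -
      have "eventually (\<lambda>x. False) p" using that by eventually_elim auto
      then show False using u by (simp add: ultrafilters_def trivial_limit_def)
    qed
    show ?thesis
    proof
      assume eq: "eventually (\<lambda>x. \<psi> x \<in> B) p \<longleftrightarrow> eventually (\<lambda>x. \<phi> x \<in> B) p"
      show "eventually (\<lambda>x. \<psi> x \<in> B \<longleftrightarrow> \<phi> x \<in> B) p"
      proof (cases "eventually (\<lambda>x. \<psi> x \<in> B) p")
        case True
        with eq have "eventually (\<lambda>x. \<phi> x \<in> B) p" by simp
        with True show ?thesis by eventually_elim auto
      next
        case False
        with eq dich have "eventually (\<lambda>x. \<psi> x \<notin> B) p" "eventually (\<lambda>x. \<phi> x \<notin> B) p" by blast+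
        then show ?thesis by eventually_elim auto
      qed
    next
      assume ev: "eventually (\<lambda>x. \<psi> x \<in> B \<longleftrightarrow> \<phi> x \<in> B) p"
      show "eventually (\<lambda>x. \<psi> x \<in> B) p \<longleftrightarrow> eventually (\<lambda>x. \<phi> x \<in> B) p"
        by (rule eventually_subst[OF ev])
    qed
  qed
  then have key: "(beta_star \<psi> p \<in> stone B \<longleftrightarrow> beta_star \<phi> p \<in> stone B) \<longleftrightarrow>
      eventually (\<lambda>x. \<psi> x \<in> B \<longleftrightarrow> \<phi> x \<in> B) p" if "p \<in> topspace omega_star" for p B
    using that by (simp only: beta_star_in_stone)
  show ?thesis
    by (simp add: cell_def eventually_sequentially_iff_omega_star beta_star_in_cont_maps[OF \<psi>] key
        cong: ball_cong)
qed

section \<open>Limits of coherent sequences of maps\<close>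

text \<open>
  If \<open>P n x\<close> holds from \<open>x = k n\<close> on, the index \<open>\<nu> x\<close> can be taken to be the largest
  \<open>n \<le> x\<close> with \<open>k n \<le> x\<close>.  This is the division of \<open>\<omega>\<close> into blocks.
\<close>

lemma eventually_diagonal:
  assumes "\<And>n :: nat. eventually (P n) sequentially"
  shows "\<exists>\<nu>. filterlim \<nu> sequentially sequentially \<and> (\<forall>\<^sub>F x in sequentially. P (\<nu> x) x)"
proof -
  obtain k where k: "\<And>n x. k n \<le> x \<Longrightarrow> P n x"
    using assms unfolding eventually_sequentially by metis
  \<comment> \<open>Admitting \<open>n = 0\<close> unconditionally makes the maximum exist for \<open>x\<close> below all thresholds.\<close>
  define \<nu> where "\<nu> x = Max {n. n \<le> x \<and> (n = 0 \<or> k n \<le> x)}" for x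
  have fin: "finite {n. n \<le> x \<and> (n = 0 \<or> k n \<le> x)}" for x by simp
  have mem: "\<nu> x \<in> {n. n \<le> x \<and> (n = 0 \<or> k n \<le> x)}" for x
    unfolding \<nu>_def using fin by (rule Max_in) auto
  have "\<forall>\<^sub>F x in sequentially. n \<le> \<nu> x" for n
    using eventually_ge_at_top[of "max n (k n)"]
    by eventually_elim (use fin in \<open>auto simp: \<nu>_def intro!: Max_ge\<close>)
  then have "filterlim \<nu> sequentially sequentially" by (simp add: filterlim_at_top)
  moreover have "\<forall>\<^sub>F x in sequentially. P (\<nu> x) x"
    using eventually_ge_at_top[of "k 0"]
  proof eventually_elim
    case (elim x)
    then show ?case using mem[of x] k[of "\<nu> x" x] by (cases "\<nu> x = 0") auto
  qed
  ultimately show ?thesis by blast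
qed

text \<open>
  A finite set \<open>\<G>\<close> has finitely many atoms, so the union of the finite ones is finite, and a
  finite-to-one map sends only finitely many points into it.
\<close>

lemma eventually_infinite_atom:
  fixes \<phi> :: "nat \<Rightarrow> nat"
  assumes \<phi>: "finite_to_one \<phi>" and G: "finite \<G>"
  shows "\<forall>\<^sub>F x in sequentially. infinite {y. \<forall>B\<in>\<G>. y \<in> B \<longleftrightarrow> \<phi> x \<in> B}"
proof -
  define atom where "atom y = {z. \<forall>B\<in>\<G>. z \<in> B \<longleftrightarrow> y \<in> B}" for y :: nat
  have "range atom \<subseteq> (\<lambda>\<D>. {z. {B\<in>\<G>. z \<in> B} = \<D>}) ` Pow \<G>" (is "_ \<subseteq> ?R")
  proof (rule image_subsetI)
    fix y
    have "atom y = {z. {B\<in>\<G>. z \<in> B} = {B\<in>\<G>. y \<in> B}}" by (auto simp: atom_def)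
    then show "atom y \<in> ?R" by (rule image_eqI) simp
  qed
  then have "finite (range atom)" by (rule finite_subset) (simp add: G)
  then have "finite {A \<in> range atom. finite A}" by simp
  then have "finite (\<Union>{A \<in> range atom. finite A})" by (intro finite_Union) auto
  moreover have "{y. finite (atom y)} \<subseteq> \<Union>{A \<in> range atom. finite A}"
    by (auto simp: atom_def)
  ultimately have "finite {y. finite (atom y)}" by (rule rev_finite_subset)
  then have "finite (\<Union>y\<in>{y. finite (atom y)}. \<phi> -` {y})"
    using \<phi> by (simp add: finite_to_one_def)
  moreover have "(\<Union>y\<in>{y. finite (atom y)}. \<phi> -` {y}) = {x. finite (atom (\<phi> x))}" by auto
  ultimately show ?thesis
    by (simp add: cofinite_eq_sequentially[symmetric] eventually_cofinite atom_def)
qed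

text \<open>
  The value \<open>\<psi> x\<close> is chosen in the atom that contains the value at \<open>x\<close> of the map assigned to the
  block of \<open>x\<close>, which leaves enough freedom to make \<open>\<psi>\<close> strictly increasing even if no \<open>\<phi> n\<close>
  is injective.
\<close>

lemma coherent_limit:
  fixes \<phi> :: "nat \<Rightarrow> nat \<Rightarrow> nat"
  assumes \<phi>: "\<And>n. finite_to_one (\<phi> n)" and F: "\<And>n. finite (\<F> n)"
    and coh: "\<And>n m B. n \<le> m \<Longrightarrow> B \<in> \<F> n \<Longrightarrow> \<forall>\<^sub>F x in sequentially. \<phi> m x \<in> B \<longleftrightarrow> \<phi> n x \<in> B"
  shows "\<exists>\<psi>. strict_mono \<psi> \<and> (\<forall>n. \<forall>B\<in>\<F> n. \<forall>\<^sub>F x in sequentially. \<psi> x \<in> B \<longleftrightarrow> \<phi> n x \<in> B)"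
proof -
  define \<G> where "\<G> n = (\<Union>j\<le>n. \<F> j)" for n
  have G: "finite (\<G> n)" for n using F by (simp add: \<G>_def)
  define A where "A n x = {y. \<forall>B\<in>\<G> n. y \<in> B \<longleftrightarrow> \<phi> n x \<in> B}" for n x
  define good where "good n x \<longleftrightarrow> infinite (A n x) \<and>
    (\<forall>j\<in>{..n}. \<forall>B\<in>\<F> j. \<phi> n x \<in> B \<longleftrightarrow> \<phi> j x \<in> B)" for n x
  have "eventually (good n) sequentially" for n
    unfolding A_def good_def using F coh
    by (intro eventually_conj eventually_infinite_atom \<phi> G eventually_ball_finite ballI) auto
  then have "\<exists>\<nu>. filterlim \<nu> sequentially sequentially \<and> (\<forall>\<^sub>F x in sequentially. good (\<nu> x) x)"
    by (rule eventually_diagonal)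
  then obtain \<nu> where \<nu>: "filterlim \<nu> sequentially sequentially"
      and good: "\<forall>\<^sub>F x in sequentially. good (\<nu> x) x"
    by (elim exE conjE)
  \<comment> \<open>At the finitely many \<open>x\<close> that are not good the atom may be finite; no value in it is asked for.\<close>
  let ?P = "\<lambda>x y. infinite (A (\<nu> x) x) \<longrightarrow> y \<in> A (\<nu> x) x"
  have step: "\<exists>z. ?P x z \<and> y < z" for x y
  proof (cases "infinite (A (\<nu> x) x)")
    case True
    then show ?thesis by (auto simp: infinite_nat_iff_unbounded)
  qed (auto intro: lessI)
  have "\<exists>\<psi>. \<forall>x. ?P x (\<psi> x) \<and> \<psi> x < \<psi> (Suc x)"
  proof (rule dependent_nat_choice)
    show "\<exists>y. ?P 0 y" using step[of 0 0] by (elim exE conjE) (rule exI)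
    show "\<exists>z. ?P (Suc x) z \<and> y < z" for x y by (rule step)
  qed
  then obtain \<psi> where \<psi>: "\<And>x. ?P x (\<psi> x)" and inc: "\<And>x. \<psi> x < \<psi> (Suc x)"
    by metis
  have "\<forall>\<^sub>F x in sequentially. \<psi> x \<in> B \<longleftrightarrow> \<phi> n x \<in> B" if B: "B \<in> \<F> n" for n B
  proof -
    have "\<forall>\<^sub>F x in sequentially. n \<le> \<nu> x" using \<nu> by (simp add: filterlim_at_top)
    with good show ?thesis
    proof eventually_elim
      case (elim x)
      have "\<psi> x \<in> A (\<nu> x) x" using \<psi>[of x] elim(1) by (simp add: good_def)
      moreover have "B \<in> \<G> (\<nu> x)" using elim(2) B unfolding \<G>_def by blast
      ultimately have "\<psi> x \<in> B \<longleftrightarrow> \<phi> (\<nu> x) x \<in> B" by (simp add: A_def)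
      also have "\<dots> \<longleftrightarrow> \<phi> n x \<in> B" using elim B by (simp add: good_def)
      finally show ?case .
    qed
  qed
  moreover have "strict_mono \<psi>" using inc by (simp add: strict_mono_Suc_iff)
  ultimately show ?thesis by (intro exI[of _ \<psi>]) simp
qed

section \<open>Spaces between \<open>S\<^sub>1(\<omega>)\<close> and \<open>S(\<omega>)\<close>\<close>

text \<open>
  The upper bound on \<open>T\<close> makes the centres of the cells that NE plays induced by finite-to-one maps,
  and the lower bound ensures that the limit, being induced by an injection, belongs to \<open>T\<close>.
\<close>

lemma Choquet_between_S1_and_S:
  assumes T: "S1_omega \<subseteq> T" "T \<subseteq> S_omega"
  shows "Choquet_space (subtopology (compact_open omega_star omega_star) T)"
    (is "Choquet_space ?Z")
proof -
  have Tc: "T \<subseteq> cont_maps omega_star omega_star"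
    using T(2) S_omega_subset(2) by (auto simp: topspace_compact_open)
  have "\<exists>f \<F>. f \<in> U \<and> f \<in> T \<and> finite \<F> \<and> cell \<F> f \<inter> T \<subseteq> U"
    if U: "openin ?Z U" "U \<noteq> {}" for U
  proof -
    obtain V where V: "openin (compact_open omega_star omega_star) V" "U = V \<inter> T"
      using U(1) by (auto simp: openin_subtopology)
    obtain f where f: "f \<in> V" "f \<in> T" using U(2) V(2) by blast
    then obtain \<F> where "finite \<F>" "cell \<F> f \<subseteq> V" using cell_neighbourhood[OF V(1)] by blast
    then show ?thesis using f V(2) by blast
  qed
  then obtain c \<F> where c: "\<And>U. openin ?Z U \<Longrightarrow> U \<noteq> {} \<Longrightarrow>
      c U \<in> U \<and> c U \<in> T \<and> finite (\<F> U) \<and> cell (\<F> U) (c U) \<inter> T \<subseteq> U"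
    by metis
  have self: "f \<in> cell \<A> f \<inter> T" if "f \<in> T" for f \<A> using that Tc by (auto simp: cell_def)
  show ?thesis
  proof (rule Choquet_space_stationary[where s = "\<lambda>U. cell (\<F> U) (c U) \<inter> T"])
    fix U assume "openin ?Z U" "U \<noteq> {}"
    note cU = c[OF this]
    have "openin (compact_open omega_star omega_star) (cell (\<F> U) (c U))"
      using cU Tc by (intro openin_cell) auto
    then have "openin ?Z (cell (\<F> U) (c U) \<inter> T)" by (rule openin_subtopology_Int)
    then show "openin ?Z (cell (\<F> U) (c U) \<inter> T) \<and> cell (\<F> U) (c U) \<inter> T \<noteq> {} \<and>
        cell (\<F> U) (c U) \<inter> T \<subseteq> U"
      using cU self by blast
  next
    fix U assume U: "\<And>n :: nat. openin ?Z (U n)" "\<And>n. U n \<noteq> {}"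
      and dec: "\<And>n. U (Suc n) \<subseteq> cell (\<F> (U n)) (c (U n)) \<inter> T"
    have cU: "c (U n) \<in> U n \<and> c (U n) \<in> T \<and> finite (\<F> (U n)) \<and>
        cell (\<F> (U n)) (c (U n)) \<inter> T \<subseteq> U n" for n
      by (rule c[OF U])
    have "\<exists>\<phi>. finite_to_one \<phi> \<and> c (U n) = beta_star \<phi>" for n
      using cU[of n] T(2) by (auto simp: S_omega_def)
    then obtain \<phi> where \<phi>: "\<And>n. finite_to_one (\<phi> n)" "\<And>n. c (U n) = beta_star (\<phi> n)" by metis
    have coh: "c (U m) \<in> cell (\<F> (U n)) (c (U n))" if "n \<le> m" for n m
    proof (cases "n = m")
      case True
      then show ?thesis using self[of "c (U m)"] cU[of m] by blast
    next
      case False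
      have anti: "U (Suc i) \<subseteq> U i" for i using dec[of i] cU[of i] by blast
      have "U m \<subseteq> U (Suc n)"
        by (rule lift_Suc_antimono_le[of U, OF anti]) (use False that in simp)
      then show ?thesis using cU[of m] dec[of n] by blast
    qed
    have "\<exists>\<psi>. strict_mono \<psi> \<and>
      (\<forall>n. \<forall>B\<in>\<F> (U n). \<forall>\<^sub>F x in sequentially. \<psi> x \<in> B \<longleftrightarrow> \<phi> n x \<in> B)"
    proof (rule coherent_limit[OF \<phi>(1)])
      show "finite (\<F> (U n))" for n using cU[of n] by simp
      show "\<forall>\<^sub>F x in sequentially. \<phi> m x \<in> B \<longleftrightarrow> \<phi> n x \<in> B"
        if "n \<le> m" "B \<in> \<F> (U n)" for n m B
        using coh[OF that(1)] that(2) \<phi>(1)[of m] by (simp add: \<phi>(2) beta_star_in_cell_iff)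
    qed
    then obtain \<psi> where \<psi>: "strict_mono \<psi>"
      "\<forall>n. \<forall>B\<in>\<F> (U n). \<forall>\<^sub>F x in sequentially. \<psi> x \<in> B \<longleftrightarrow> \<phi> n x \<in> B"
      by (elim exE conjE)
    have inj: "inj \<psi>" using \<psi>(1) by (rule strict_mono_imp_inj_on)
    then have "finite_to_one \<psi>" by (auto simp: finite_to_one_def intro: finite_vimageI)
    then have "beta_star \<psi> \<in> cell (\<F> (U n)) (c (U n))" for n
      using \<psi>(2) by (simp add: \<phi>(2) beta_star_in_cell_iff)
    moreover have "beta_star \<psi> \<in> T" using inj T(1) by (auto simp: S1_omega_def)
    ultimately show "(\<Inter>n. cell (\<F> (U n)) (c (U n)) \<inter> T) \<noteq> {}" by blast
  qed
qed

theorem corollary5p14: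
  shows "Choquet_space (subtopology (compact_open omega_star omega_star) S1_omega)
       \<and> Baire_space (subtopology (compact_open omega_star omega_star) S1_omega)
       \<and> Choquet_space (subtopology (compact_open omega_star omega_star) S_omega)
       \<and> Baire_space (subtopology (compact_open omega_star omega_star) S_omega)"
  by (intro conjI Choquet_imp_Baire Choquet_between_S1_and_S order_refl S_omega_subset(1))

end
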